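(* Let $A$ be a unital complete atomistic inverse $\wedge$-semigroup, let $T$ be an inverse semigroup with zero, and let $\rho\colon T\to A$ be a $0$-representation. Then $\rho$ is a $0$-direct sum of irreducible weakly effective $0$-representations in local algebras of $A$. That is, there are a family $(A_\alpha)_{\alpha\in I}$ of local algebras of $A$ and $0$-representations $\rho_\alpha\colon T\to A_\alpha$ $(\alpha\in I)$ such that, writing $S_\alpha=T\rho_\alpha$: (1) the image $T\rho$ is the $0$-direct sum of its subsemigroups $S_\alpha$, $\alpha\in I$, and for all $t\in T$ and $\alpha\in I$ one has $t\rho_\alpha=t\rho$ if $t\rho\in S_\alpha$ and $t\rho_\alpha=0$ otherwise; (2) each $S_\alpha$ is irreducible; (3) each $S_\alpha$ is weakly effective in $A_\alpha$.
   Context: Maps are written on the right. An inverse $\wedge$-semigroup is an inverse semigroup $A$ in which every two elements have a greatest lower bound $a\wedge b$ in the natural partial order ($a\le b$ iff $a=eb$ for some idempotent $e$). $A$ is complete if every non-empty subset has an infimum in the natural order; then $A$ has a bottom element $0=\inf A$, which is a multiplicative zero, and every subset that is bounded above has a supremum. $A$ is unital if it has an identity element $1_A$. $A$ is atomistic if every element is a supremum of atoms (atoms being the minimal non-zero elements). A local algebra of $A$ is a subset $eAe$ with $e=e^2\in A$; it is an inverse $\wedge$-semigroup with identity $e$ and zero $0$. "Subsemigroup" always means inverse subsemigroup. A representation of an inverse semigroup $T$ in $A$ is a semigroup homomorphism $\rho\colon T\to A$; it is a $0$-representation if $T$ has a zero $0_T$ and $0_T\rho=0_A$ (for a local algebra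 the zero is again $0=0_A$). A semigroup $T'$ with zero $0$ is the $0$-direct sum of subsemigroups $T_\alpha$ (pairwise $0$-disjoint, i.e. with no common non-zero elements) if $T'\setminus\{0\}=\bigcup_\alpha (T_\alpha\setminus\{0\})$ and $tu=0$ whenever $t\in T_\alpha$, $u\in T_\beta$ with $\alpha\ne\beta$ (products of two elements of the same $T_\alpha$ being formed in $T_\alpha$). The $T_\alpha$ are called summands. A semigroup with zero is irreducible if it cannot be written as a $0$-direct sum having more than one non-trivial summand (non-trivial: $\neq\{0\}$). The $0$-direct sum of the empty family is $\{0\}$. A subsemigroup $S$ of a unital complete atomistic inverse $\wedge$-semigroup $A'$ is weakly effective (in $A'$) if $S\subseteq eA'e$ with $e=e^2\in A'$ implies $e=1_{A'}$. *)

theory Defs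
  imports Main
begin

text \<open>
  Semigroups are subsets of an ambient type of class \<open>semigroup_mult\<close> that are closed under
  multiplication. This costs no generality: a semigroup on a non-empty subset \<open>C\<close> of a type is
  extended to the whole type by \<open>x * y = r x * r y\<close>, where \<open>r\<close> is any retraction onto \<open>C\<close>.
  Order, zero and identity are always taken relative to the given set, so that they make sense
  for local algebras and for images of representations too.
\<close>

definition semigroup_on :: "'a::semigroup_mult set \<Rightarrow> bool" where
  "semigroup_on S \<longleftrightarrow> (\<forall>x\<in>S. \<forall>y\<in>S. x * y \<in> S)"

definition inverse_semigroup :: "'a::semigroup_mult set \<Rightarrow> bool" where
  "inverse_semigroup S \<longleftrightarrow>
     semigroup_on S \<and> (\<forall>a\<in>S. \<exists>!b. b \<in> S \<and> a * b * a = a \<and> b * a * b = b)"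

definition inverse_subsemigroup :: "'a::semigroup_mult set \<Rightarrow> 'a set \<Rightarrow> bool" where
  "inverse_subsemigroup S A \<longleftrightarrow> S \<subseteq> A \<and> inverse_semigroup S"

definition is_zero :: "'a::semigroup_mult set \<Rightarrow> 'a \<Rightarrow> bool" where
  "is_zero S z \<longleftrightarrow> z \<in> S \<and> (\<forall>x\<in>S. z * x = z \<and> x * z = z)"

definition has_zero :: "'a::semigroup_mult set \<Rightarrow> bool" where
  "has_zero S \<longleftrightarrow> (\<exists>z. is_zero S z)"

definition zero_of :: "'a::semigroup_mult set \<Rightarrow> 'a" where
  "zero_of S = (THE z. is_zero S z)"

definition is_identity :: "'a::semigroup_mult set \<Rightarrow> 'a \<Rightarrow> bool" where
  "is_identity S u \<longleftrightarrow> u \<in> S \<and> (\<forall>x\<in>S. u * x = x \<and> x * u = x)"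

definition unital :: "'a::semigroup_mult set \<Rightarrow> bool" where
  "unital S \<longleftrightarrow> (\<exists>u. is_identity S u)"

definition identity_of :: "'a::semigroup_mult set \<Rightarrow> 'a" where
  "identity_of S = (THE u. is_identity S u)"

lemma zero_of_eqI: "is_zero S z \<Longrightarrow> zero_of S = z"
  unfolding zero_of_def by (rule the_equality) (assumption, metis is_zero_def)

lemma identity_of_eqI: "is_identity S u \<Longrightarrow> identity_of S = u"
  unfolding identity_of_def by (rule the_equality) (assumption, metis is_identity_def)

definition natural_le :: "'a::semigroup_mult set \<Rightarrow> 'a \<Rightarrow> 'a \<Rightarrow> bool" where
  "natural_le A a b \<longleftrightarrow> (\<exists>e\<in>A. e * e = e \<and> a = e * b)"

definition is_infimum :: "'a::semigroup_mult set \<Rightarrow> 'a set \<Rightarrow> 'a \<Rightarrow> bool" where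
  "is_infimum A X m \<longleftrightarrow>
     m \<in> A \<and> (\<forall>x\<in>X. natural_le A m x) \<and>
     (\<forall>y\<in>A. (\<forall>x\<in>X. natural_le A y x) \<longrightarrow> natural_le A y m)"

definition is_supremum :: "'a::semigroup_mult set \<Rightarrow> 'a set \<Rightarrow> 'a \<Rightarrow> bool" where
  "is_supremum A X m \<longleftrightarrow>
     m \<in> A \<and> (\<forall>x\<in>X. natural_le A x m) \<and>
     (\<forall>y\<in>A. (\<forall>x\<in>X. natural_le A x y) \<longrightarrow> natural_le A m y)"

definition inverse_meet_semigroup :: "'a::semigroup_mult set \<Rightarrow> bool" where
  "inverse_meet_semigroup A \<longleftrightarrow>
     inverse_semigroup A \<and> (\<forall>a\<in>A. \<forall>b\<in>A. \<exists>m. is_infimum A {a, b} m)"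

definition complete :: "'a::semigroup_mult set \<Rightarrow> bool" where
  "complete A \<longleftrightarrow> (\<forall>X. X \<subseteq> A \<and> X \<noteq> {} \<longrightarrow> (\<exists>m. is_infimum A X m))"

definition atoms :: "'a::semigroup_mult set \<Rightarrow> 'a set" where
  "atoms A = {a \<in> A. a \<noteq> zero_of A \<and>
     (\<forall>b\<in>A. natural_le A b a \<and> b \<noteq> zero_of A \<longrightarrow> b = a)}"

definition atomistic :: "'a::semigroup_mult set \<Rightarrow> bool" where
  "atomistic A \<longleftrightarrow> (\<forall>a\<in>A. \<exists>X. X \<subseteq> atoms A \<and> is_supremum A X a)"

definition unital_complete_atomistic :: "'a::semigroup_mult set \<Rightarrow> bool" where
  "unital_complete_atomistic A \<longleftrightarrow>
     inverse_meet_semigroup A \<and> unital A \<and> complete A \<and> atomistic A"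

definition corner :: "'a::semigroup_mult set \<Rightarrow> 'a \<Rightarrow> 'a set" where
  "corner A e = {e * a * e | a. a \<in> A}"

definition local_algebra :: "'a::semigroup_mult set \<Rightarrow> 'a set \<Rightarrow> bool" where
  "local_algebra A B \<longleftrightarrow> (\<exists>e\<in>A. e * e = e \<and> B = corner A e)"

definition zero_representation ::
    "'t::semigroup_mult set \<Rightarrow> 'a::semigroup_mult set \<Rightarrow> ('t \<Rightarrow> 'a) \<Rightarrow> bool" where
  "zero_representation T A \<rho> \<longleftrightarrow>
     (\<forall>t\<in>T. \<rho> t \<in> A) \<and> (\<forall>s\<in>T. \<forall>t\<in>T. \<rho> (s * t) = \<rho> s * \<rho> t) \<and>
     has_zero T \<and> \<rho> (zero_of T) = zero_of A"

text \<open>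
  The summands of a 0-direct sum are semigroups with the same zero as the sum, hence the
  requirement \<open>zero_of S \<in> F i\<close>. Products inside one summand need no clause, since
  the summands are subsemigroups.
\<close>

definition zero_direct_sum ::
    "'a::semigroup_mult set \<Rightarrow> 'i set \<Rightarrow> ('i \<Rightarrow> 'a set) \<Rightarrow> bool" where
  "zero_direct_sum S I F \<longleftrightarrow>
     semigroup_on S \<and> has_zero S \<and>
     (\<forall>i\<in>I. inverse_subsemigroup (F i) S \<and> zero_of S \<in> F i) \<and>
     (\<forall>i\<in>I. \<forall>j\<in>I. i \<noteq> j \<longrightarrow> F i \<inter> F j \<subseteq> {zero_of S}) \<and>
     S - {zero_of S} = (\<Union>i\<in>I. F i - {zero_of S}) \<and>
     (\<forall>i\<in>I. \<forall>j\<in>I. i \<noteq> j \<longrightarrow> (\<forall>t\<in>F i. \<forall>u\<in>F j. t * u = zero_of S))"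

text \<open>
  Distinct non-trivial summands are distinct subsets, so index sets of type \<open>'a set set\<close> are
  large enough to cover every decomposition (up to repetitions of the trivial summand).
\<close>

definition irreducible_semigroup :: "'a::semigroup_mult set \<Rightarrow> bool" where
  "irreducible_semigroup S \<longleftrightarrow>
     semigroup_on S \<and> has_zero S \<and>
     \<not> (\<exists>(I :: 'a set set) F. zero_direct_sum S I F \<and>
          (\<exists>i\<in>I. \<exists>j\<in>I. i \<noteq> j \<and> F i \<noteq> {zero_of S} \<and> F j \<noteq> {zero_of S}))"

definition weakly_effective :: "'a::semigroup_mult set \<Rightarrow> 'a set \<Rightarrow> bool" where
  "weakly_effective A S \<longleftrightarrow>
     unital_complete_atomistic A \<and> inverse_subsemigroup S A \<and>
     (\<forall>e\<in>A. e * e = e \<and> S \<subseteq> corner A e \<longrightarrow> e = identity_of A)"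

end

theory Submission
  imports Defs
begin

text \<open>
  Why the theorem holds. Two facts of different kinds are combined.

  The first concerns only the image \<open>S = \<rho> ` T\<close>, an inverse semigroup with zero. Join two non-zero
  elements of \<open>S\<close> by an edge when they have a non-zero product in at least one order. Elements of
  different connected components then annihilate each other by definition. A component together
  with zero is a subsemigroup because a non-zero product \<open>s * t\<close> is still joined to the inverse of
  \<open>t\<close>, and this inverse is joined to \<open>t\<close>. Hence \<open>S\<close> is the 0-direct sum of its components
  (\<open>zero_direct_sum_components\<close>). A component is irreducible since an edge never joins two different
  summands of a 0-direct sum (\<open>irreducible_component\<close>). Projecting \<open>\<rho>\<close> onto one component is multiplicative; this works in any
  0-direct sum (\<open>zero_direct_sum_projection_mult\<close>).

  The second concerns \<open>A\<close>. For any \<open>C \<subseteq> A\<close>, the idempotents \<open>f\<close> with \<open>C \<subseteq> f A f\<close> include \<open>1\<close>, and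
  their infimum \<open>e\<close> is again one of them: \<open>C \<subseteq> f A f\<close> means that all the idempotents \<open>s s\<inverse>\<close> and
  \<open>s\<inverse> s\<close> with \<open>s \<in> C\<close> are below \<open>f\<close>, and lower bounds pass to the infimum. By minimality of \<open>e\<close>, an
  inverse subsemigroup \<open>C\<close> is weakly effective in \<open>e A e\<close> (\<open>weakly_effective_corner_exists\<close>).
  Local algebras are down-sets of \<open>A\<close> with the induced order, so that completeness and atomisticity are inherited from \<open>A\<close>.
\<close>

section \<open>Inverse semigroups and the natural order\<close>

definition inverse_in :: "'a::semigroup_mult set \<Rightarrow> 'a \<Rightarrow> 'a" where
  "inverse_in A a = (THE b. b \<in> A \<and> a * b * a = a \<and> b * a * b = b)"

lemma inverse_in:
  assumes "inverse_semigroup A" and "a \<in> A"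
  shows "inverse_in A a \<in> A"
    and "a * inverse_in A a * a = a"
    and "inverse_in A a * a * inverse_in A a = inverse_in A a"
proof -
  have "\<exists>!b. b \<in> A \<and> a * b * a = a \<and> b * a * b = b"
    using assms by (simp add: inverse_semigroup_def)
  from theI'[OF this] show "inverse_in A a \<in> A"
    and "a * inverse_in A a * a = a"
    and "inverse_in A a * a * inverse_in A a = inverse_in A a"
    by (simp_all add: inverse_in_def)
qed

lemma inverse_in_idempotents:
  assumes "inverse_semigroup A" and "a \<in> A"
  shows "(a * inverse_in A a) * (a * inverse_in A a) = a * inverse_in A a"
    and "(inverse_in A a * a) * (inverse_in A a * a) = inverse_in A a * a"
  using inverse_in[OF assms] by (simp_all add: mult.assoc[symmetric])

lemma inverse_unique:
  assumes "inverse_semigroup A" and "a \<in> A" and "b \<in> A" and "c \<in> A"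
    and "a * b * a = a" and "b * a * b = b" and "a * c * a = a" and "c * a * c = c"
  shows "b = c"
  using assms unfolding inverse_semigroup_def by metis

lemma mult_closed: "inverse_semigroup A \<Longrightarrow> a \<in> A \<Longrightarrow> b \<in> A \<Longrightarrow> a * b \<in> A"
  by (simp add: inverse_semigroup_def semigroup_on_def)

text \<open>Uniqueness of inverses is inherited from the larger semigroup, so only existence matters.\<close>

lemma inverse_semigroup_subset:
  assumes "inverse_semigroup A" and "S \<subseteq> A"
    and "\<And>a b. a \<in> S \<Longrightarrow> b \<in> S \<Longrightarrow> a * b \<in> S"
    and "\<And>a. a \<in> S \<Longrightarrow> \<exists>b\<in>S. a * b * a = a \<and> b * a * b = b"
  shows "inverse_semigroup S"
  unfolding inverse_semigroup_def semigroup_on_def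
proof (intro conjI ballI)
  fix a assume a: "a \<in> S"
  obtain b where b: "b \<in> S" "a * b * a = a" "b * a * b = b" using assms(4)[OF a] by blast
  show "\<exists>!b. b \<in> S \<and> a * b * a = a \<and> b * a * b = b"
  proof (rule ex1I[of _ b])
    fix c assume "c \<in> S \<and> a * c * a = a \<and> c * a * c = c"
    then show "c = b"
      using inverse_unique[OF assms(1), of a c b] a b assms(2) by blast
  qed (use b in simp)
qed (use assms(3) in blast)

text \<open>
  The inverse \<open>x\<close> of \<open>e f\<close> equals \<open>f x e\<close>, because the latter is also an inverse. This makes \<open>x\<close>
  idempotent, hence its own inverse, hence equal to \<open>e f\<close>.
\<close>

lemma idempotent_product:
  assumes A: "inverse_semigroup A" and e: "e \<in> A" "e * e = e" and f: "f \<in> A" "f * f = f"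
  shows "(e * f) * (e * f) = e * f"
proof -
  define x where "x = inverse_in A (e * f)"
  have ef: "e * f \<in> A" using mult_closed[OF A] e f by blast
  note x = inverse_in[OF A ef, folded x_def]
  have ee: "e * (e * y) = e * y" and ff: "f * (f * y) = f * y" for y
    using e f by (simp_all add: mult.assoc[symmetric])
  have x1: "e * (f * (x * (e * f))) = e * f" using x(2) by (simp add: mult.assoc)
  have x2: "x * (e * (f * (x * y))) = x * y" for y
    using arg_cong[OF x(3), of "\<lambda>u. u * y"] by (simp add: mult.assoc)
  have "f * x * e \<in> A" using mult_closed[OF A] e f x by blast
  then have eq: "f * x * e = x"
    by (rule inverse_unique[OF A ef _ x(1) _ _ x(2,3)])
      (use x1 x2 in \<open>simp_all add: mult.assoc ee ff\<close>)
  have idem: "x * x = x"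
  proof -
    have "x * x = (f * x * e) * (f * x * e)" by (simp only: eq)
    also have "\<dots> = f * x * e" using x2 by (simp add: mult.assoc)
    finally show ?thesis by (simp only: eq)
  qed
  have "e * f = x"
    by (rule inverse_unique[OF A x(1) ef x(1) x(3,2)]) (simp_all add: idem)
  then show ?thesis using idem by simp
qed

text \<open>Both \<open>e f\<close> and \<open>f e\<close> are inverses of \<open>e f\<close>.\<close>

lemma idempotents_commute:
  assumes A: "inverse_semigroup A" and e: "e \<in> A" "e * e = e" and f: "f \<in> A" "f * f = f"
  shows "e * f = f * e"
proof -
  have ee: "e * (e * y) = e * y" and ff: "f * (f * y) = f * y" for y
    using e f by (simp_all add: mult.assoc[symmetric])
  note ef = idempotent_product[OF A e f] and fe = idempotent_product[OF A f e]
  have mem: "e * f \<in> A" "f * e \<in> A" using mult_closed[OF A] e f by blast+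
  show ?thesis
    by (rule inverse_unique[OF A mem(1) mem])
      (use ef fe in \<open>simp_all add: mult.assoc ee ff\<close>)
qed

text \<open>
  The natural order is left-right symmetric: moving an idempotent \<open>e\<close> past \<open>b\<close> turns it into
  \<open>b\<inverse> e b\<close>.
\<close>

lemma natural_le_right:
  assumes A: "inverse_semigroup A" and le: "natural_le A a b" and b: "b \<in> A"
  obtains f where "f \<in> A" "f * f = f" "a = b * f"
proof -
  obtain e where e: "e \<in> A" "e * e = e" "a = e * b"
    using le by (auto simp: natural_le_def)
  define c where "c = inverse_in A b"
  note c = inverse_in[OF A b, folded c_def]
  have bc: "b * c \<in> A" "(b * c) * (b * c) = b * c"
    using c b mult_closed[OF A] inverse_in_idempotents[OF A b] by (auto simp: c_def)
  have comm: "b * c * e = e * (b * c)" using idempotents_commute[OF A bc e(1,2)] .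
  have "b * (c * e * b) = (b * c * e) * b" by (simp only: mult.assoc)
  also have "\<dots> = (e * (b * c)) * b" by (simp only: comm)
  also have "\<dots> = e * (b * c * b)" by (simp only: mult.assoc)
  finally have a: "a = b * (c * e * b)" using c(2) e(3) by simp
  have "(c * e * b) * (c * e * b) = c * (e * (b * c) * e) * b" by (simp add: mult.assoc)
  also have "e * (b * c) * e = b * c * (e * e)" by (simp only: comm[symmetric] mult.assoc[of "b * c"])
  also have "c * (b * c * (e * e)) * b = (c * b * c) * e * b" by (simp only: e(2) mult.assoc)
  also have "\<dots> = c * e * b" by (simp only: c(3))
  finally show ?thesis using that[of "c * e * b"] a c(1) e(1) b mult_closed[OF A] by blast
qed

lemma natural_le_idempotent:
  assumes A: "inverse_semigroup A" and le: "natural_le A a b" and b: "b \<in> A" "b * b = b"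
  shows "a * a = a" and "b * a = a" and "a * b = a"
proof -
  obtain e where e: "e \<in> A" "e * e = e" "a = e * b"
    using le by (auto simp: natural_le_def)
  show "a * a = a" using idempotent_product[OF A e(1,2) b] e(3) by simp
  show "a * b = a" using e(3) b by (simp add: mult.assoc)
  then show "b * a = a" using idempotents_commute[OF A e(1,2) b] e(3) b
    by (metis mult.assoc)
qed

text \<open>
  The bottom element \<open>m\<close> lies below \<open>1\<close> and is therefore idempotent; and for an idempotent \<open>m\<close>,
  being below \<open>x\<close> forces \<open>m = m x = x m\<close>.
\<close>

lemma complete_unital_zero:
  assumes A: "inverse_semigroup A" and "unital A" and "complete A"
  shows "is_zero A (zero_of A)"
proof -
  obtain u where u: "is_identity A u" using assms by (auto simp: unital_def)
  then have uA: "u \<in> A" "u * u = u" by (auto simp: is_identity_def)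
  then obtain m where m: "is_infimum A A m" using assms(3) by (auto simp: complete_def)
  then have mA: "m \<in> A" and le: "\<And>x. x \<in> A \<Longrightarrow> natural_le A m x"
    by (auto simp: is_infimum_def)
  have mm: "m * m = m" using natural_le_idempotent(1)[OF A le[OF uA(1)] uA] .
  have "is_zero A m" unfolding is_zero_def
  proof (intro conjI ballI mA)
    fix x assume x: "x \<in> A"
    obtain e where e: "e \<in> A" "e * e = e" "m = e * x"
      using le[OF x] by (auto simp: natural_le_def)
    have "e * m = m" using e by (simp add: mult.assoc[symmetric])
    then have "m * e = m" using idempotents_commute[OF A mA mm e(1,2)] by simp
    then show "m * x = m" using e(3) mm by (metis mult.assoc)
    obtain f where f: "f \<in> A" "f * f = f" "m = x * f"
      using natural_le_right[OF A le[OF x] x] .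
    have "m * f = m" using f by (simp add: mult.assoc)
    then have "f * m = m" using idempotents_commute[OF A mA mm f(1,2)] by simp
    then show "x * m = m" using f(3) mm by (metis mult.assoc)
  qed
  then show ?thesis using zero_of_eqI by metis
qed

lemma is_zero_zero_of: "has_zero S \<Longrightarrow> is_zero S (zero_of S)"
  using zero_of_eqI by (auto simp: has_zero_def)

section \<open>Local algebras\<close>

lemma mem_corner_iff:
  assumes "inverse_semigroup A" and "e \<in> A" and "e * e = e"
  shows "x \<in> corner A e \<longleftrightarrow> x \<in> A \<and> e * x = x \<and> x * e = x"
proof
  assume "x \<in> corner A e"
  then obtain a where a: "a \<in> A" "x = e * a * e" by (auto simp: corner_def)
  have "e * (e * y) = e * y" for y using assms(3) by (simp add: mult.assoc[symmetric])
  then show "x \<in> A \<and> e * x = x \<and> x * e = x"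
    using a assms mult_closed[OF assms(1)] by (simp add: mult.assoc)
next
  assume "x \<in> A \<and> e * x = x \<and> x * e = x"
  then have "x \<in> A" "x = e * x * e" by simp_all
  then show "x \<in> corner A e" unfolding corner_def mem_Collect_eq by (intro exI conjI)
qed

lemma corner_down_closed:
  assumes A: "inverse_semigroup A" and e: "e \<in> A" "e * e = e"
    and le: "natural_le A a b" and b: "b \<in> corner A e"
  shows "a \<in> corner A e"
proof -
  have b': "b \<in> A" "e * b = b" "b * e = b" using b mem_corner_iff[OF A e] by auto
  obtain f where f: "f \<in> A" "f * f = f" "a = f * b" using le by (auto simp: natural_le_def)
  have "e * a = a"
    using idempotents_commute[OF A e f(1,2)] f(3) b'(2) by (metis mult.assoc)
  moreover have "a * e = a" using f(3) b'(3) by (simp add: mult.assoc)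
  ultimately show ?thesis
    using mem_corner_iff[OF A e] f b' mult_closed[OF A] by auto
qed

lemma natural_le_corner_iff:
  assumes A: "inverse_semigroup A" and e: "e \<in> A" "e * e = e"
    and b: "b \<in> corner A e"
  shows "natural_le (corner A e) a b \<longleftrightarrow> natural_le A a b"
proof
  assume "natural_le (corner A e) a b"
  then show "natural_le A a b"
    using mem_corner_iff[OF A e] by (auto simp: natural_le_def)
next
  assume "natural_le A a b"
  then obtain f where f: "f \<in> A" "f * f = f" "a = f * b" by (auto simp: natural_le_def)
  have b': "b \<in> A" "e * b = b" using b mem_corner_iff[OF A e] by auto
  have comm: "e * f = f * e" by (rule idempotents_commute[OF A e f(1,2)])
  have idem: "(f * e) * (f * e) = f * e" by (rule idempotent_product[OF A f(1,2) e])
  have "e * (e * f) = e * f" "f * e * e = f * e"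
    using e(2) by (simp add: mult.assoc[symmetric], simp add: mult.assoc)
  then have "e * (f * e) = f * e" "f * e * e = f * e" using comm by simp_all
  then have "f * e \<in> corner A e"
    using mem_corner_iff[OF A e] mult_closed[OF A f(1) e(1)] by simp
  moreover have "a = (f * e) * b" using f(3) b'(2) by (simp add: mult.assoc)
  ultimately show "natural_le (corner A e) a b"
    using idem by (auto simp: natural_le_def)
qed

lemma inverse_semigroup_corner:
  assumes A: "inverse_semigroup A" and e: "e \<in> A" "e * e = e"
  shows "inverse_semigroup (corner A e)"
proof (rule inverse_semigroup_subset[OF A])
  show "corner A e \<subseteq> A" using mem_corner_iff[OF A e] by blast
next
  fix a b assume "a \<in> corner A e" "b \<in> corner A e"
  then have ab: "a \<in> A" "e * a = a" "b \<in> A" "b * e = b"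
    using mem_corner_iff[OF A e] by auto
  then have "e * (a * b) = a * b" "(a * b) * e = a * b"
    by (simp add: mult.assoc[symmetric], simp add: mult.assoc)
  then show "a * b \<in> corner A e"
    using mem_corner_iff[OF A e] mult_closed[OF A] ab by simp
next
  fix a assume "a \<in> corner A e"
  then have a: "a \<in> A" "e * a = a" "a * e = a" using mem_corner_iff[OF A e] by auto
  define c where "c = inverse_in A a"
  note c = inverse_in[OF A a(1), folded c_def]
  have "e * c * e \<in> corner A e" using c(1) by (auto simp: corner_def)
  moreover have "a * (e * c * e) * a = (a * e) * c * (e * a)"
    "(e * c * e) * a * (e * c * e) = e * (c * ((e * a) * e) * c) * e"
    by (simp_all only: mult.assoc)
  then have "a * (e * c * e) * a = a" "(e * c * e) * a * (e * c * e) = e * c * e"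
    using a(2,3) c(2,3) by simp_all
  ultimately show "\<exists>b\<in>corner A e. a * b * a = a \<and> b * a * b = b" by blast
qed

lemma is_zero_corner:
  assumes A: "inverse_semigroup A" and e: "e \<in> A" "e * e = e" and z: "is_zero A z"
  shows "is_zero (corner A e) z"
  using z e by (simp add: is_zero_def mem_corner_iff[OF A e])

lemma is_identity_corner:
  assumes A: "inverse_semigroup A" and e: "e \<in> A" "e * e = e"
  shows "is_identity (corner A e) e"
  using e by (simp add: is_identity_def mem_corner_iff[OF A e])

lemma is_infimum_corner:
  assumes A: "inverse_semigroup A" and e: "e \<in> A" "e * e = e"
    and X: "X \<subseteq> corner A e" "X \<noteq> {}" and m: "is_infimum A X m"
  shows "is_infimum (corner A e) X m"
proof -
  obtain x where x: "x \<in> X" using X by blast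
  have mC: "m \<in> corner A e"
    using corner_down_closed[OF A e, of m x] x X m by (auto simp: is_infimum_def)
  show ?thesis unfolding is_infimum_def
  proof (intro conjI ballI impI mC)
    fix y assume y: "y \<in> X"
    then have "natural_le A m y" using m by (simp add: is_infimum_def)
    then show "natural_le (corner A e) m y"
      using natural_le_corner_iff[OF A e] X y by blast
  next
    fix y assume y: "y \<in> corner A e" "\<forall>x\<in>X. natural_le (corner A e) y x"
    then have "\<forall>x\<in>X. natural_le A y x"
      using X natural_le_corner_iff[OF A e] by blast
    moreover have "y \<in> A" using y(1) mem_corner_iff[OF A e] by blast
    ultimately show "natural_le (corner A e) y m"
      using m natural_le_corner_iff[OF A e mC] by (auto simp: is_infimum_def)
  qed
qed

text \<open>
  Since a local algebra is a down-set with the induced order, its atoms are those of the whole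
  semigroup that it contains, and atoms below one of its elements belong to it.
\<close>

lemma atomistic_corner:
  assumes A: "inverse_semigroup A" and e: "e \<in> A" "e * e = e" and z: "is_zero A z"
    and at: "atomistic A"
  shows "atomistic (corner A e)"
  unfolding atomistic_def
proof
  fix a assume a: "a \<in> corner A e"
  then have "a \<in> A" using mem_corner_iff[OF A e] by blast
  then obtain X where X: "X \<subseteq> atoms A" "is_supremum A X a"
    using at by (auto simp: atomistic_def)
  have XC: "X \<subseteq> corner A e"
    using X(2) corner_down_closed[OF A e _ a] by (auto simp: is_supremum_def)
  have zero: "zero_of (corner A e) = zero_of A"
    using zero_of_eqI[OF z] zero_of_eqI[OF is_zero_corner[OF A e z]] by simp
  have "X \<subseteq> atoms (corner A e)"
  proof
    fix x assume x: "x \<in> X"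
    then have xC: "x \<in> corner A e" and xa: "x \<in> atoms A" using XC X by auto
    have "b = x" if "b \<in> corner A e" "natural_le (corner A e) b x" "b \<noteq> zero_of A" for b
    proof -
      have "natural_le A b x" "b \<in> A"
        using that natural_le_corner_iff[OF A e xC] mem_corner_iff[OF A e] by auto
      then show ?thesis using xa that(3) by (auto simp: atoms_def)
    qed
    moreover have "x \<noteq> zero_of A" using xa by (simp add: atoms_def)
    ultimately show "x \<in> atoms (corner A e)" using xC by (simp add: atoms_def zero)
  qed
  moreover have "is_supremum (corner A e) X a" unfolding is_supremum_def
  proof (intro conjI ballI impI a)
    fix x assume "x \<in> X"
    then show "natural_le (corner A e) x a"
      using X natural_le_corner_iff[OF A e a] by (auto simp: is_supremum_def)
  next
    fix y assume y: "y \<in> corner A e" "\<forall>x\<in>X. natural_le (corner A e) x y"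
    then have "y \<in> A" "\<forall>x\<in>X. natural_le A x y"
      using natural_le_corner_iff[OF A e y(1)] mem_corner_iff[OF A e] by auto
    then show "natural_le (corner A e) a y"
      using X natural_le_corner_iff[OF A e y(1)] by (auto simp: is_supremum_def)
  qed
  ultimately show "\<exists>X. X \<subseteq> atoms (corner A e) \<and> is_supremum (corner A e) X a" by blast
qed

lemma unital_complete_atomistic_corner:
  assumes A: "unital_complete_atomistic A" and e: "e \<in> A" "e * e = e"
  shows "unital_complete_atomistic (corner A e)"
proof -
  have inv: "inverse_semigroup A" and u: "unital A" and c: "complete A" and at: "atomistic A"
    using A by (auto simp: unital_complete_atomistic_def inverse_meet_semigroup_def)
  have sub: "corner A e \<subseteq> A" using mem_corner_iff[OF inv e] by blast
  have inf: "\<exists>m. is_infimum (corner A e) X m" if "X \<subseteq> corner A e" "X \<noteq> {}" for X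
  proof -
    obtain m where "is_infimum A X m" using c \<open>X \<subseteq> corner A e\<close> \<open>X \<noteq> {}\<close> sub
      unfolding complete_def by (meson order_trans)
    then show ?thesis using is_infimum_corner[OF inv e that] by blast
  qed
  have "inverse_meet_semigroup (corner A e)"
    using inverse_semigroup_corner[OF inv e] inf by (auto simp: inverse_meet_semigroup_def)
  moreover have "unital (corner A e)"
    using is_identity_corner[OF inv e] by (auto simp: unital_def)
  moreover have "complete (corner A e)" using inf by (auto simp: complete_def)
  moreover have "atomistic (corner A e)"
    using atomistic_corner[OF inv e complete_unital_zero[OF inv u c] at] .
  ultimately show ?thesis by (simp add: unital_complete_atomistic_def)
qed

text \<open>
  Multiplication by \<open>f\<close> on the left fixes \<open>s\<close> exactly when it fixes \<open>s s\<inverse>\<close>, and dually on the right.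
  Expressed by order relations with \<open>f\<close> as upper bound, the condition \<open>s \<in> f A f\<close> becomes visibly
  stable under infima of \<open>f\<close>.
\<close>

lemma mem_corner_iff_natural_le:
  assumes A: "inverse_semigroup A" and s: "s \<in> A" and f: "f \<in> A" "f * f = f"
  shows "s \<in> corner A f \<longleftrightarrow>
    natural_le A (s * inverse_in A s) f \<and> natural_le A (inverse_in A s * s) f"
proof -
  define c where "c = inverse_in A s"
  note c = inverse_in[OF A s, folded c_def]
  have id: "s * c \<in> A" "(s * c) * (s * c) = s * c" "c * s \<in> A" "(c * s) * (c * s) = c * s"
    using c s mult_closed[OF A] inverse_in_idempotents[OF A s] by (auto simp: c_def)
  show ?thesis unfolding c_def[symmetric]
  proof
    assume "s \<in> corner A f"
    then have "f * s = s" "s * f = s" using mem_corner_iff[OF A f] by auto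
    then have "f * (s * c) = s * c" "(c * s) * f = c * s"
      by (simp add: mult.assoc[symmetric], simp add: mult.assoc)
    then have "s * c = (s * c) * f" "c * s = (c * s) * f"
      using idempotents_commute[OF A f id(1,2)] by simp_all
    then show "natural_le A (s * c) f \<and> natural_le A (c * s) f"
      using id unfolding natural_le_def by (intro conjI bexI)
  next
    assume le: "natural_le A (s * c) f \<and> natural_le A (c * s) f"
    have "f * (s * c) = s * c" "(c * s) * f = c * s"
      using natural_le_idempotent[OF A _ f] le by auto
    then have "f * (s * c * s) = s * c * s" "(s * c * s) * f = s * c * s"
      by (simp add: mult.assoc[symmetric], simp add: mult.assoc)
    then have "f * s = s" "s * f = s" unfolding c(2) .
    then show "s \<in> corner A f" using mem_corner_iff[OF A f] s by blast
  qed
qed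

lemma smallest_corner_exists:
  assumes A: "unital_complete_atomistic A" and C: "C \<subseteq> A"
  obtains e where "e \<in> A" "e * e = e" "C \<subseteq> corner A e"
    "\<And>f. f \<in> A \<Longrightarrow> f * f = f \<Longrightarrow> C \<subseteq> corner A f \<Longrightarrow> natural_le A e f"
proof -
  have inv: "inverse_semigroup A" and un: "unital A" and c: "complete A"
    using A by (auto simp: unital_complete_atomistic_def inverse_meet_semigroup_def)
  define E where "E = {f \<in> A. f * f = f \<and> C \<subseteq> corner A f}"
  obtain u where u: "is_identity A u" using un by (auto simp: unital_def)
  then have uA: "u \<in> A" "u * u = u" by (auto simp: is_identity_def)
  have "C \<subseteq> corner A u"
    using u C mem_corner_iff[OF inv uA] by (auto simp: is_identity_def)
  then have uE: "u \<in> E" using uA by (simp add: E_def)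
  moreover have "E \<subseteq> A" by (auto simp: E_def)
  ultimately obtain e where e: "is_infimum A E e" using c unfolding complete_def by blast
  have eA: "e \<in> A" and le: "\<And>f. f \<in> E \<Longrightarrow> natural_le A e f"
    and greatest: "\<And>y. y \<in> A \<Longrightarrow> \<forall>f\<in>E. natural_le A y f \<Longrightarrow> natural_le A y e"
    using e by (auto simp: is_infimum_def)
  have ee: "e * e = e" using natural_le_idempotent(1)[OF inv le[OF uE] uA] .
  have "C \<subseteq> corner A e"
  proof
    fix s assume s: "s \<in> C"
    then have sA: "s \<in> A" using C by blast
    have mem: "s * inverse_in A s \<in> A" "inverse_in A s * s \<in> A"
      using sA inverse_in(1)[OF inv sA] mult_closed[OF inv] by auto
    have "natural_le A (s * inverse_in A s) f \<and> natural_le A (inverse_in A s * s) f"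
      if "f \<in> E" for f
      using that s mem_corner_iff_natural_le[OF inv sA, of f] by (auto simp: E_def)
    then show "s \<in> corner A e"
      unfolding mem_corner_iff_natural_le[OF inv sA eA ee] using greatest mem by blast
  qed
  then show ?thesis using that[OF eA ee] le by (simp add: E_def)
qed

text \<open>
  Let \<open>e A e\<close> be the smallest local algebra containing \<open>C\<close>. An idempotent \<open>f \<in> e A e\<close> satisfies
  \<open>f \<le> e\<close>; if \<open>C \<subseteq> f A f\<close> as well, then \<open>e \<le> f\<close>.
\<close>

lemma weakly_effective_corner_exists:
  assumes A: "unital_complete_atomistic A" and C: "inverse_subsemigroup C A"
  obtains e where "e \<in> A" "e * e = e" "weakly_effective (corner A e) C"
proof -
  have inv: "inverse_semigroup A"
    using A by (auto simp: unital_complete_atomistic_def inverse_meet_semigroup_def)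
  have CA: "C \<subseteq> A" using C by (simp add: inverse_subsemigroup_def)
  obtain e where e: "e \<in> A" "e * e = e" and Ce: "C \<subseteq> corner A e"
    and least: "\<And>f. f \<in> A \<Longrightarrow> f * f = f \<Longrightarrow> C \<subseteq> corner A f \<Longrightarrow> natural_le A e f"
    using smallest_corner_exists[OF A CA] by blast
  have "f = identity_of (corner A e)"
    if f: "f \<in> corner A e" "f * f = f" "C \<subseteq> corner (corner A e) f" for f
  proof -
    have f': "f \<in> A" "e * f = f" using f(1) mem_corner_iff[OF inv e] by auto
    have "C \<subseteq> corner A f"
      using f(3) mem_corner_iff[OF inv e] by (auto simp: corner_def)
    then have "natural_le A e f" using least[OF f'(1) f(2)] by blast
    then have "e * f = e" using natural_le_idempotent(3)[OF inv _ f'(1) f(2)] by blast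
    then show ?thesis
      using f'(2) identity_of_eqI[OF is_identity_corner[OF inv e]] by simp
  qed
  then have "weakly_effective (corner A e) C"
    using unital_complete_atomistic_corner[OF A e] Ce C
    by (auto simp: weakly_effective_def inverse_subsemigroup_def)
  then show ?thesis using that e by blast
qed

section \<open>Components of an inverse semigroup with zero\<close>

definition linked :: "'a::semigroup_mult set \<Rightarrow> ('a \<times> 'a) set" where
  "linked S = {(s, t). s \<in> S - {zero_of S} \<and> t \<in> S - {zero_of S} \<and>
     (s * t \<noteq> zero_of S \<or> t * s \<noteq> zero_of S)}"

text \<open>Zero is adjoined to every component, because the summands of a 0-direct sum share it.\<close>

definition component :: "'a::semigroup_mult set \<Rightarrow> 'a \<Rightarrow> 'a set" where
  "component S s = insert (zero_of S) ((linked S)\<^sup>* `` {s})"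

definition components :: "'a::semigroup_mult set \<Rightarrow> 'a set set" where
  "components S = component S ` (S - {zero_of S})"

lemma sym_linked: "sym (linked S)"
  by (auto simp: linked_def sym_def)

lemma linked_rtrancl_mem:
  assumes "(s, t) \<in> (linked S)\<^sup>*" and "s \<in> S - {zero_of S}"
  shows "t \<in> S - {zero_of S}"
  using assms by (induction rule: rtrancl_induct) (auto simp: linked_def)

lemma component_eq:
  assumes "t \<in> component S s" and "t \<noteq> zero_of S"
  shows "component S t = component S s"
proof -
  have st: "(s, t) \<in> (linked S)\<^sup>*" using assms by (auto simp: component_def)
  then have "(t, s) \<in> (linked S)\<^sup>*" using sym_rtrancl[OF sym_linked] by (auto dest: symD)
  with st have "(linked S)\<^sup>* `` {t} = (linked S)\<^sup>* `` {s}"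
    by (auto intro: rtrancl_trans)
  then show ?thesis by (simp add: component_def)
qed

lemma component_self: "s \<in> component S s"
  by (simp add: component_def)

lemma linked_imp_component_eq: "(s, t) \<in> linked S \<Longrightarrow> component S s = component S t"
  using component_eq[of t S s] by (auto simp: component_def linked_def)

lemma component_subset:
  assumes "is_zero S (zero_of S)" and "s \<in> S - {zero_of S}"
  shows "component S s \<subseteq> S"
  using assms linked_rtrancl_mem[of s _ S] by (auto simp: component_def is_zero_def)

lemma component_annihilate:
  assumes "s \<in> S - {zero_of S}" and "t \<in> S - {zero_of S}"
    and "component S s \<noteq> component S t"
  shows "s * t = zero_of S"
  using assms linked_imp_component_eq[of s t S] by (auto simp: linked_def)

text \<open>The product \<open>s s\<inverse>\<close> is not zero, as it fixes \<open>s\<close>; so \<open>s\<close> and \<open>s\<inverse>\<close> are linked.\<close>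

lemma component_inverse:
  assumes S: "inverse_semigroup S" and z: "is_zero S (zero_of S)" and s: "s \<in> S - {zero_of S}"
  shows "inverse_in S s \<in> S - {zero_of S}"
    and "component S (inverse_in S s) = component S s"
proof -
  have sS: "s \<in> S" using s by simp
  note c = inverse_in[OF S sS]
  have sc: "s * inverse_in S s \<noteq> zero_of S"
    using c(2) z s by (auto simp: is_zero_def)
  then have "inverse_in S s \<noteq> zero_of S" using z sS by (auto simp: is_zero_def)
  then show mem: "inverse_in S s \<in> S - {zero_of S}" using c by simp
  have "(inverse_in S s, s) \<in> linked S" using mem s sc by (auto simp: linked_def)
  then show "component S (inverse_in S s) = component S s"
    by (rule linked_imp_component_eq)
qed

text \<open>
  If \<open>s t \<noteq> 0\<close> then \<open>s t t\<inverse> \<noteq> 0\<close>, as multiplying it by \<open>t\<close> gives \<open>s t\<close> back. So \<open>s t\<close> is linked to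
  \<open>t\<inverse>\<close>.
\<close>

lemma component_mult:
  assumes S: "inverse_semigroup S" and z: "is_zero S (zero_of S)"
    and s: "s \<in> S" and t: "t \<in> S" and st: "s * t \<noteq> zero_of S"
  shows "component S (s * t) = component S t"
proof -
  have t': "t \<in> S - {zero_of S}" using st z s t by (auto simp: is_zero_def)
  let ?c = "inverse_in S t"
  note c = inverse_in[OF S t]
  have "s * t * ?c * t = s * t" using c(2) by (simp add: mult.assoc)
  then have "s * t * ?c \<noteq> zero_of S" using st z t by (auto simp: is_zero_def)
  moreover have "s * t \<in> S" using mult_closed[OF S s t] .
  ultimately have "(s * t, ?c) \<in> linked S"
    using component_inverse(1)[OF S z t'] st by (auto simp: linked_def)
  then show ?thesis
    using linked_imp_component_eq component_inverse(2)[OF S z t'] by metis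
qed

lemma inverse_semigroup_component:
  assumes S: "inverse_semigroup S" and z: "is_zero S (zero_of S)" and s: "s \<in> S - {zero_of S}"
  shows "inverse_semigroup (component S s)"
proof (rule inverse_semigroup_subset[OF S component_subset[OF z s]])
  fix a b assume a: "a \<in> component S s" and b: "b \<in> component S s"
  have mem: "a \<in> S" "b \<in> S" using a b component_subset[OF z s] by auto
  show "a * b \<in> component S s"
  proof (cases "a * b = zero_of S")
    case True
    then show ?thesis by (simp add: component_def)
  next
    case False
    then have "b \<noteq> zero_of S" using z mem by (auto simp: is_zero_def)
    then show ?thesis
      using component_mult[OF S z mem False] component_eq[OF b] component_self[of "a * b" S]
      by simp
  qed
next
  fix a assume a: "a \<in> component S s"
  show "\<exists>b\<in>component S s. a * b * a = a \<and> b * a * b = b"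
  proof (cases "a = zero_of S")
    case True
    then show ?thesis using a z by (intro bexI[of _ a]) (auto simp: is_zero_def)
  next
    case False
    then have a': "a \<in> S - {zero_of S}" using a component_subset[OF z s] by blast
    then have "inverse_in S a \<in> component S s"
      using component_inverse(2)[OF S z a'] component_eq[OF a False]
        component_self[of "inverse_in S a" S] by simp
    then show ?thesis using inverse_in(2,3)[OF S] a' by blast
  qed
qed

lemma is_zero_component:
  assumes "is_zero S (zero_of S)" and "s \<in> S - {zero_of S}"
  shows "is_zero (component S s) (zero_of S)"
  using component_subset[OF assms] assms(1) by (auto simp: is_zero_def component_def)

lemma zero_direct_sum_components:
  assumes S: "inverse_semigroup S" and z: "is_zero S (zero_of S)"
  shows "zero_direct_sum S (components S) (\<lambda>C. C)"
  unfolding zero_direct_sum_def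
proof (intro conjI ballI impI)
  show "semigroup_on S" using S by (simp add: inverse_semigroup_def)
  show "has_zero S" using z by (auto simp: has_zero_def)
next
  fix C assume "C \<in> components S"
  then obtain s where s: "s \<in> S - {zero_of S}" "C = component S s"
    by (auto simp: components_def)
  then show "inverse_subsemigroup C S" "zero_of S \<in> C"
    using inverse_semigroup_component[OF S z] component_subset[OF z]
    by (auto simp: inverse_subsemigroup_def component_def)
next
  fix C D assume CD: "C \<in> components S" "D \<in> components S" "C \<noteq> D"
  then obtain s t where s: "s \<in> S - {zero_of S}" "C = component S s"
    and t: "t \<in> S - {zero_of S}" "D = component S t"
    by (auto simp: components_def)
  show "C \<inter> D \<subseteq> {zero_of S}"
  proof
    fix x assume "x \<in> C \<inter> D"
    then show "x \<in> {zero_of S}"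
      using component_eq[of x S s] component_eq[of x S t] s t CD(3) by auto
  qed
  fix x y assume x: "x \<in> C" and y: "y \<in> D"
  have mem: "x \<in> S" "y \<in> S"
    using component_subset[OF z s(1)] component_subset[OF z t(1)] x y s(2) t(2) by auto
  show "x * y = zero_of S"
  proof (cases "x = zero_of S \<or> y = zero_of S")
    case True
    then show ?thesis using z mem by (auto simp: is_zero_def)
  next
    case False
    then show ?thesis
      using component_annihilate[of x S y] component_eq[of x S s] component_eq[of y S t]
        mem x y s t CD(3) by auto
  qed
next
  show "S - {zero_of S} = (\<Union>C\<in>components S. C - {zero_of S})"
    using component_subset[OF z] component_self by (fastforce simp: components_def)
qed

text \<open>
  Two linked elements lie in the same summand of any 0-direct decomposition, because elements of
  different summands have product zero in both orders. So the summand of an element is constant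
  along paths, and a connected component meets only one summand.
\<close>

lemma irreducible_component:
  assumes S: "inverse_semigroup S" and z: "is_zero S (zero_of S)" and s: "s \<in> S - {zero_of S}"
  shows "irreducible_semigroup (component S s)"
proof -
  let ?C = "component S s" and ?z = "zero_of S"
  have zC: "is_zero ?C ?z" using is_zero_component[OF z s] .
  have zero: "zero_of ?C = ?z" using zero_of_eqI[OF zC] .
  have False
    if ds: "zero_direct_sum ?C I F" and ij: "i \<in> I" "j \<in> I" "i \<noteq> j" "F i \<noteq> {?z}" "F j \<noteq> {?z}"
    for I :: "'a set set" and F i j
  proof -
    have zF: "\<And>k. k \<in> I \<Longrightarrow> ?z \<in> F k"
      and disj: "\<And>k l. k \<in> I \<Longrightarrow> l \<in> I \<Longrightarrow> k \<noteq> l \<Longrightarrow> F k \<inter> F l \<subseteq> {?z}"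
      and cover: "?C - {?z} = (\<Union>k\<in>I. F k - {?z})"
      and ann: "\<And>k l t u. k \<in> I \<Longrightarrow> l \<in> I \<Longrightarrow> k \<noteq> l \<Longrightarrow> t \<in> F k \<Longrightarrow> u \<in> F l \<Longrightarrow> t * u = ?z"
      using ds by (simp_all add: zero_direct_sum_def zero)
    obtain x where x: "x \<in> F i" "x \<noteq> ?z" using zF[OF ij(1)] ij(4) by blast
    obtain y where y: "y \<in> F j" "y \<noteq> ?z" using zF[OF ij(2)] ij(5) by blast
    have xC: "x \<in> ?C" and yC: "y \<in> ?C" using cover x y ij by blast+
    have eq: "component S x = ?C" using component_eq[OF xC x(2)] .
    then have path: "(x, y) \<in> (linked S)\<^sup>*" using yC y(2) by (auto simp: component_def)
    have "y \<in> F i" using path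
    proof (induction rule: rtrancl_induct)
      case base
      show ?case by (rule x(1))
    next
      case (step u v)
      have "(x, v) \<in> (linked S)\<^sup>*" using step.hyps by (rule rtrancl_into_rtrancl)
      then have "v \<in> ?C" using eq unfolding component_def by blast
      moreover have "v \<noteq> ?z" using step.hyps(2) by (auto simp: linked_def)
      ultimately obtain k where k: "k \<in> I" "v \<in> F k" using cover by blast
      have "k = i"
        using ann[of i k u v] ann[of k i v u] k step.IH step.hyps(2) ij(1)
        by (auto simp: linked_def)
      then show ?case using k by simp
    qed
    then show False using disj[OF ij(1,2,3)] y by blast
  qed
  moreover have "semigroup_on ?C"
    using inverse_semigroup_component[OF S z s] by (simp add: inverse_semigroup_def)
  moreover have "has_zero ?C" using zC by (auto simp: has_zero_def)
  ultimately show ?thesis unfolding irreducible_semigroup_def zero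
    by (intro conjI notI) (assumption+, elim exE conjE bexE)
qed

section \<open>Projections and the decomposition of a representation\<close>

text \<open>
  If one factor lies outside \<open>F i\<close>, the product contributes nothing to \<open>F i\<close>: either the factors belong
  to different summands and the product is zero, or both belong to one other summand \<open>F k\<close>, which
  meets \<open>F i\<close> in zero only.
\<close>

lemma zero_direct_sum_projection_mult:
  assumes ds: "zero_direct_sum S I F" and i: "i \<in> I" and a: "a \<in> S" and b: "b \<in> S"
  defines "p \<equiv> \<lambda>x. if x \<in> F i then x else zero_of S"
  shows "p (a * b) = p a * p b"
proof -
  have z: "is_zero S (zero_of S)"
    using ds is_zero_zero_of by (auto simp: zero_direct_sum_def)
  have zF: "\<And>k. k \<in> I \<Longrightarrow> zero_of S \<in> F k"
    and sub: "\<And>k. k \<in> I \<Longrightarrow> inverse_semigroup (F k)"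
    and disj: "\<And>k l. k \<in> I \<Longrightarrow> l \<in> I \<Longrightarrow> k \<noteq> l \<Longrightarrow> F k \<inter> F l \<subseteq> {zero_of S}"
    and cover: "S - {zero_of S} = (\<Union>k\<in>I. F k - {zero_of S})"
    and ann: "\<And>k l t u. k \<in> I \<Longrightarrow> l \<in> I \<Longrightarrow> k \<noteq> l \<Longrightarrow> t \<in> F k \<Longrightarrow> u \<in> F l \<Longrightarrow> t * u = zero_of S"
    using ds by (simp_all add: zero_direct_sum_def inverse_subsemigroup_def)
  have zz: "zero_of S * x = zero_of S" "x * zero_of S = zero_of S" if "x \<in> S" for x
    using z that by (simp_all add: is_zero_def)
  have other_summand: "\<exists>l\<in>I. l \<noteq> k \<and> x \<in> F l" if "k \<in> I" "x \<in> S" "x \<notin> F k" for x k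
  proof -
    have "x \<noteq> zero_of S" using that(3) zF[OF that(1)] by blast
    then have "x \<in> (\<Union>k\<in>I. F k - {zero_of S})" unfolding cover[symmetric]
      using that(2) by blast
    then obtain l where "l \<in> I" "x \<in> F l" by blast
    moreover from this have "l \<noteq> k" using that(3) by auto
    ultimately show ?thesis by (intro bexI conjI)
  qed
  show ?thesis
  proof (cases "a \<in> F i")
    case True
    show ?thesis
    proof (cases "b \<in> F i")
      case True
      with \<open>a \<in> F i\<close> show ?thesis using mult_closed[OF sub[OF i]] by (simp add: p_def)
    next
      case False
      then obtain k where "k \<in> I" "k \<noteq> i" "b \<in> F k" using other_summand[OF i b] by blast
      then have "a * b = zero_of S" using ann[of i k a b] i \<open>a \<in> F i\<close> by blast
      then show ?thesis using True False zz a by (simp add: p_def)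
    qed
  next
    case False
    then obtain k where k: "k \<in> I" "k \<noteq> i" "a \<in> F k" using other_summand[OF i a] by blast
    have "p (a * b) = zero_of S"
    proof (cases "b \<in> F k")
      case True
      then have "a * b \<in> F k" using mult_closed[OF sub[OF k(1)]] k by blast
      then show ?thesis using disj[OF i k(1)] k(2) by (auto simp: p_def)
    next
      case False
      then obtain l where "l \<in> I" "l \<noteq> k" "b \<in> F l"
        using other_summand[OF k(1) b] by blast
      then have "a * b = zero_of S" using ann[of k l a b] k by blast
      then show ?thesis by (simp add: p_def)
    qed
    moreover have "p b \<in> S" using b z by (simp add: p_def is_zero_def)
    ultimately show ?thesis using False zz by (simp add: p_def)
  qed
qed

text \<open>
  An inverse of \<open>t\<close> in \<open>T\<close> is mapped to an inverse of \<open>\<rho> t\<close>; uniqueness comes from \<open>A\<close>.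
\<close>

lemma inverse_semigroup_image:
  assumes A: "inverse_semigroup A" and T: "inverse_semigroup T" and r: "zero_representation T A \<rho>"
  shows "inverse_semigroup (\<rho> ` T)"
proof -
  have mem: "\<And>t. t \<in> T \<Longrightarrow> \<rho> t \<in> A"
    and hom: "\<And>s t. s \<in> T \<Longrightarrow> t \<in> T \<Longrightarrow> \<rho> (s * t) = \<rho> s * \<rho> t"
    using r by (auto simp: zero_representation_def)
  show ?thesis
  proof (rule inverse_semigroup_subset[OF A])
    show "\<rho> ` T \<subseteq> A" using mem by blast
  next
    fix a b assume "a \<in> \<rho> ` T" "b \<in> \<rho> ` T"
    then obtain s t where st: "s \<in> T" "t \<in> T" "a = \<rho> s" "b = \<rho> t" by blast
    then have "a * b = \<rho> (s * t)" using hom by simp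
    then show "a * b \<in> \<rho> ` T" using mult_closed[OF T] st by blast
  next
    fix a assume "a \<in> \<rho> ` T"
    then obtain t where t: "t \<in> T" "a = \<rho> t" by blast
    note c = inverse_in[OF T t(1)]
    have "\<rho> (t * inverse_in T t * t) = a * \<rho> (inverse_in T t) * a"
      "\<rho> (inverse_in T t * t * inverse_in T t) = \<rho> (inverse_in T t) * a * \<rho> (inverse_in T t)"
      using t c(1) hom mult_closed[OF T] by simp_all
    then have "a * \<rho> (inverse_in T t) * a = a"
      "\<rho> (inverse_in T t) * a * \<rho> (inverse_in T t) = \<rho> (inverse_in T t)"
      using t(2) c(2,3) by simp_all
    then show "\<exists>b\<in>\<rho> ` T. a * b * a = a \<and> b * a * b = b" using c(1) by blast
  qed
qed

lemma is_zero_image: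
  assumes z: "is_zero A (zero_of A)" and r: "zero_representation T A \<rho>"
  shows "is_zero (\<rho> ` T) (zero_of A)"
proof -
  have "is_zero T (zero_of T)"
    using r is_zero_zero_of by (auto simp: zero_representation_def)
  then have "\<rho> (zero_of T) \<in> \<rho> ` T" by (simp add: is_zero_def)
  then have "zero_of A \<in> \<rho> ` T"
    using r by (simp add: zero_representation_def)
  then show ?thesis using z r by (auto simp: is_zero_def zero_representation_def)
qed


theorem theorem3p4:
  fixes A :: "'a::semigroup_mult set"
    and T :: "'t::semigroup_mult set"
    and \<rho> :: "'t \<Rightarrow> 'a"
  assumes "unital_complete_atomistic A"
    and "inverse_semigroup T"
    and "has_zero T"
    and "zero_representation T A \<rho>"
  shows "\<exists>(I :: 'a set set) (B :: 'a set \<Rightarrow> 'a set) (\<sigma> :: 'a set \<Rightarrow> 't \<Rightarrow> 'a).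
    (\<forall>\<alpha>\<in>I. local_algebra A (B \<alpha>) \<and> zero_representation T (B \<alpha>) (\<sigma> \<alpha>)) \<and>
    zero_direct_sum (\<rho> ` T) I (\<lambda>\<alpha>. \<sigma> \<alpha> ` T) \<and>
    (\<forall>t\<in>T. \<forall>\<alpha>\<in>I. \<sigma> \<alpha> t = (if \<rho> t \<in> \<sigma> \<alpha> ` T then \<rho> t else zero_of A)) \<and>
    (\<forall>\<alpha>\<in>I. irreducible_semigroup (\<sigma> \<alpha> ` T)) \<and>
    (\<forall>\<alpha>\<in>I. weakly_effective (B \<alpha>) (\<sigma> \<alpha> ` T))"
proof -
  have A: "inverse_semigroup A" and zA: "is_zero A (zero_of A)"
    using assms(1) complete_unital_zero
    by (auto simp: unital_complete_atomistic_def inverse_meet_semigroup_def)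
  have mem: "\<And>t. t \<in> T \<Longrightarrow> \<rho> t \<in> A"
    and hom: "\<And>s t. s \<in> T \<Longrightarrow> t \<in> T \<Longrightarrow> \<rho> (s * t) = \<rho> s * \<rho> t"
    and rz: "\<rho> (zero_of T) = zero_of A"
    using assms(4) by (auto simp: zero_representation_def)
  have zT: "zero_of T \<in> T"
    using is_zero_zero_of[OF assms(3)] by (simp add: is_zero_def)
  define S where "S = \<rho> ` T"
  have S: "inverse_semigroup S"
    unfolding S_def by (rule inverse_semigroup_image[OF A assms(2,4)])
  have "is_zero S (zero_of A)" unfolding S_def by (rule is_zero_image[OF zA assms(4)])
  then have zeroS: "zero_of S = zero_of A" and z: "is_zero S (zero_of S)"
    using zero_of_eqI by metis+
  have SA: "S \<subseteq> A" using mem by (auto simp: S_def)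
  have ds: "zero_direct_sum S (components S) (\<lambda>C. C)"
    using zero_direct_sum_components[OF S z] .
  have comp: "inverse_subsemigroup C S" "zero_of A \<in> C" if "C \<in> components S" for C
    using ds that zeroS by (auto simp: zero_direct_sum_def)
  have irr: "irreducible_semigroup C" if "C \<in> components S" for C
    using that irreducible_component[OF S z] by (auto simp: components_def)

  have "\<exists>e. e \<in> A \<and> e * e = e \<and> weakly_effective (corner A e) C" if "C \<in> components S" for C
  proof -
    have "inverse_subsemigroup C A" using comp(1)[OF that] SA
      by (auto simp: inverse_subsemigroup_def)
    then show ?thesis using weakly_effective_corner_exists[OF assms(1)] by metis
  qed
  then obtain \<epsilon> where \<epsilon>: "\<epsilon> C \<in> A" "\<epsilon> C * \<epsilon> C = \<epsilon> C"
    and we: "weakly_effective (corner A (\<epsilon> C)) C" if "C \<in> components S" for C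
    by metis

  define \<sigma> where "\<sigma> = (\<lambda>C t. if \<rho> t \<in> C then \<rho> t else zero_of A)"
  have image: "\<sigma> C ` T = C" if C: "C \<in> components S" for C
  proof
    show "\<sigma> C ` T \<subseteq> C" using comp(2)[OF C] by (auto simp: \<sigma>_def)
    show "C \<subseteq> \<sigma> C ` T"
    proof
      fix x assume x: "x \<in> C"
      then obtain t where "t \<in> T" "x = \<rho> t"
        using comp(1)[OF C] by (auto simp: inverse_subsemigroup_def S_def)
      with x show "x \<in> \<sigma> C ` T" by (intro image_eqI[of _ _ t]) (auto simp: \<sigma>_def)
    qed
  qed
  have rep: "zero_representation T (corner A (\<epsilon> C)) (\<sigma> C)" if C: "C \<in> components S" for C
    unfolding zero_representation_def
  proof (intro conjI ballI assms(3))
    fix t assume "t \<in> T"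
    then have "\<sigma> C t \<in> C" using image[OF C] by blast
    then show "\<sigma> C t \<in> corner A (\<epsilon> C)"
      using we[OF C] by (auto simp: weakly_effective_def inverse_subsemigroup_def)
  next
    fix s t assume s: "s \<in> T" and t: "t \<in> T"
    have "\<rho> s \<in> S" "\<rho> t \<in> S" using s t by (auto simp: S_def)
    from zero_direct_sum_projection_mult[OF ds C this]
    show "\<sigma> C (s * t) = \<sigma> C s * \<sigma> C t" unfolding \<sigma>_def zeroS hom[OF s t] .
  next
    have "zero_of (corner A (\<epsilon> C)) = zero_of A"
      using zero_of_eqI[OF is_zero_corner[OF A \<epsilon>[OF C] zA]] .
    then show "\<sigma> C (zero_of T) = zero_of (corner A (\<epsilon> C))" by (simp add: \<sigma>_def rz)
  qed
  have "zero_direct_sum (\<rho> ` T) (components S) (\<lambda>C. \<sigma> C ` T)"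
    using ds unfolding zero_direct_sum_def S_def[symmetric] by (simp add: image cong: SUP_cong)
  moreover have "\<forall>C\<in>components S. local_algebra A (corner A (\<epsilon> C))"
    using \<epsilon> unfolding local_algebra_def by blast
  moreover have "\<forall>t\<in>T. \<forall>C\<in>components S.
      \<sigma> C t = (if \<rho> t \<in> \<sigma> C ` T then \<rho> t else zero_of A)"
    using image by (simp add: \<sigma>_def)
  ultimately show ?thesis using rep irr we image
    by (intro exI[of _ "components S"] exI[of _ "\<lambda>C. corner A (\<epsilon> C)"] exI[of _ \<sigma>]) simp
qed

end
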